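(* Let $\mathcal{G}=(\mathcal{N},\mathcal{X}=\prod_{i=1}^N\mathbb{R}^{n_i},\{u_i\}_{i=1}^N)$ be a $\lambda$-cocoercive continuous game ($\lambda>0$) whose set of Nash equilibria $\mathcal{X}^*$ is nonempty. Let $(\mathbf{x}_t)_{t\ge0}$ be the noisy online gradient descent iterates $\mathbf{x}_{t+1}=\mathbf{x}_t+\eta_{t+1}(\mathbf{v}(\mathbf{x}_t)+\xi_{t+1})$ with absolute random noise, i.e. $\mathbb{E}[\xi_{t+1}\mid\mathcal{F}_t]=0$ and $\mathbb{E}[\|\xi_{t+1}\|^2\mid\mathcal{F}_t]\le\sigma_t^2$ for all $t\ge0$, where $\sigma_t^2\in(0,\sigma^2]$ for some $\sigma^2<+\infty$. Suppose the step-size sequence satisfies $$\sum_{t=1}^\infty\eta_t=+\infty,\qquad\sum_{t=1}^\infty\eta_t^2<+\infty.$$ Then $\mathbf{x}_t$ converges to $\mathcal{X}^*$ almost surely.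
   Context: A continuous game $\mathcal{G}=(\mathcal{N},\mathcal{X}=\prod_{i=1}^N\mathcal{X}_i,\{u_i\}_{i=1}^N)$ consists of a finite set of players $\mathcal{N}=\{1,\dots,N\}$, action sets $\mathcal{X}_i$ (here $\mathcal{X}_i=\mathbb{R}^{n_i}$), and payoff functions $u_i:\mathcal{X}\to\mathbb{R}$ such that each $u_i$ is continuous in $\mathbf{x}$, continuously differentiable in $x_i$, and the partial gradient $\nabla_{x_i}u_i(\mathbf{x})$ is Lipschitz continuous in $\mathbf{x}$. Write $v_i(\mathbf{x})=\nabla_{x_i}u_i(\mathbf{x})$ and $\mathbf{v}(\mathbf{x})=(v_1(\mathbf{x}),\dots,v_N(\mathbf{x}))$. A point $\mathbf{x}^*\in\mathcal{X}$ is a Nash equilibrium if for every $i$, $u_i(x_i^*,\mathbf{x}_{-i}^* )\ge u_i(x_i,\mathbf{x}_{-i}^* )$ for all $x_i\in\mathcal{X}_i$, where $\mathbf{x}_{-i}$ denotes the joint action of all players except $i$. The game is $\lambda$-cocoercive if $(\mathbf{x}'-\mathbf{x})^\top(\mathbf{v}(\mathbf{x}')-\mathbf{v}(\mathbf{x}))\le-\lambda\|\mathbf{v}(\mathbf{x}')-\mathbf{v}(\mathbf{x})\|^2$ for all $\mathbf{x},\mathbf{x}'\in\mathcal{X}$. The norm $\|\cdot\|$ is Euclidean. The initial point $\mathbf{x}_0$ is arbitrary (deterministic). The noise $(\xi_t)_{t\ge1}$ is an $L^2$-bounded martingale difference sequence adapted to the history $(\mathcal{F}_t)$ of the iterates ($\mathbf{x}_t$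 and $\xi_t$ are $\mathcal{F}_t$-measurable). The step-sizes $\eta_t>0$ form a deterministic nonincreasing sequence, and the $\sigma_t$ are deterministic. "$\mathbf{x}_t$ converges to $\mathcal{X}^*$" means that the distance from $\mathbf{x}_t$ to the set $\mathcal{X}^*$ tends to $0$. *)

theory Defs
  imports "HOL-Probability.Probability"
begin

section \<open>Continuous games on Euclidean action spaces\<close>

text \<open>
  The players form a finite type \<open>'i\<close>. All scalar action coordinates of all players form a finite
  type \<open>'k\<close>, and \<open>own k\<close> is the player who controls coordinate \<open>k\<close>. Thus \<open>real ^ 'k\<close>, with its
  Euclidean norm, is the joint action space, namely the product over \<open>i\<close> of the spaces of
  dimension \<open>n i = card {k. own k = i}\<close>; the dimensions may differ between players.
\<close>

text \<open>
  \<open>deviate own i y x\<close> is the joint action in which player \<open>i\<close> plays the \<open>i\<close>-block of \<open>y\<close> and all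
  others play as in \<open>x\<close>. The other blocks of \<open>y\<close> are irrelevant, so letting \<open>y\<close> range over
  \<open>real ^ 'k\<close> amounts to letting the action of player \<open>i\<close> range over all of its action set.
\<close>

definition deviate :: "('k \<Rightarrow> 'i) \<Rightarrow> 'i \<Rightarrow> real ^ 'k \<Rightarrow> real ^ 'k \<Rightarrow> real ^ ('k::finite)" where
  "deviate own i y x = (\<chi> k. if own k = i then y $ k else x $ k)"

text \<open>
  The partial gradient with respect to the action of player \<open>i\<close>, embedded in \<open>real ^ 'k\<close>: since
  \<open>\<lambda>y. f (deviate own i y x)\<close> depends only on the \<open>i\<close>-block of \<open>y\<close>, its gradient vanishes
  outside that block.
\<close>

definition partial_gradient ::
    "('k \<Rightarrow> 'i) \<Rightarrow> 'i \<Rightarrow> (real ^ 'k \<Rightarrow> real) \<Rightarrow> real ^ 'k \<Rightarrow> real ^ ('k::finite)" where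
  "partial_gradient own i f x = (THE g. GDERIV (\<lambda>y. f (deviate own i y x)) x :> g)"

lemma partial_gradient_eqI:
  assumes "GDERIV (\<lambda>y. f (deviate own i y x)) x :> g"
  shows "partial_gradient own i f x = g"
  unfolding partial_gradient_def
proof (rule the_equality)
  fix h assume "GDERIV (\<lambda>y. f (deviate own i y x)) x :> h"
  with assms have "(\<lambda>z. inner z h) = (\<lambda>z. inner z g)"
    unfolding gderiv_def by (rule has_derivative_unique[rotated])
  then show "h = g"
    by (metis vector_eq_rdot inner_commute)
qed (rule assms)

lemma partial_gradient_other_block:
  fixes f :: "real ^ ('k::finite) \<Rightarrow> real"
  assumes "GDERIV (\<lambda>y. f (deviate own i y x)) x :> g" and "own k \<noteq> i"
  shows "partial_gradient own i f x $ k = 0"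
proof -
  let ?F = "\<lambda>y. f (deviate own i y x)"
  have shift: "?F (x + s *\<^sub>R axis k 1) = ?F x" for s
    using assms(2) by (intro arg_cong[where f = f]) (auto simp: deviate_def vec_eq_iff axis_def)
  have d: "((\<lambda>s. x + s *\<^sub>R axis k 1) has_derivative (\<lambda>s. s *\<^sub>R axis k 1)) (at (0::real))"
    by (auto intro!: derivative_eq_intros)
  have "((\<lambda>s. ?F (x + s *\<^sub>R axis k 1)) has_derivative (\<lambda>s. inner (s *\<^sub>R axis k 1) g)) (at 0)"
    using has_derivative_compose[OF d, of ?F "\<lambda>h. inner h g"] assms(1) by (simp add: gderiv_def)
  moreover have "((\<lambda>s. ?F (x + s *\<^sub>R axis k 1)) has_derivative (\<lambda>s. 0)) (at 0)"
    unfolding shift by simp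
  ultimately have "(\<lambda>s. inner (s *\<^sub>R axis k 1) g) = (\<lambda>s. 0)"
    by (rule has_derivative_unique)
  from fun_cong[OF this, of 1] show ?thesis
    by (simp add: partial_gradient_eqI[OF assms(1)] inner_axis')
qed

definition continuous_game :: "('k \<Rightarrow> 'i) \<Rightarrow> ('i \<Rightarrow> real ^ ('k::finite) \<Rightarrow> real) \<Rightarrow> bool" where
  "continuous_game own u \<longleftrightarrow> (\<forall>i.
     continuous_on UNIV (u i) \<and>
     (\<forall>x. \<exists>g. GDERIV (\<lambda>y. u i (deviate own i y x)) x :> g) \<and>
     (\<forall>x. continuous_on UNIV (\<lambda>y. partial_gradient own i (u i) (deviate own i y x))) \<and>
     (\<exists>L. lipschitz_on L UNIV (partial_gradient own i (u i))))"

text \<open>The joint field \<open>v = (v\<^sub>1, \<dots>, v\<^sub>N)\<close>: its \<open>i\<close>-block is the \<open>i\<close>-block of \<open>v\<^sub>i\<close>.\<close>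

definition gradient_field ::
    "('k \<Rightarrow> 'i) \<Rightarrow> ('i \<Rightarrow> real ^ 'k \<Rightarrow> real) \<Rightarrow> real ^ 'k \<Rightarrow> real ^ ('k::finite)" where
  "gradient_field own u x = (\<chi> k. partial_gradient own (own k) (u (own k)) x $ k)"

definition nash_equilibria ::
    "('k \<Rightarrow> 'i) \<Rightarrow> ('i \<Rightarrow> real ^ 'k \<Rightarrow> real) \<Rightarrow> (real ^ ('k::finite)) set" where
  "nash_equilibria own u = {x. \<forall>i y. u i x \<ge> u i (deviate own i y x)}"

definition cocoercive_game ::
    "real \<Rightarrow> ('k \<Rightarrow> 'i) \<Rightarrow> ('i \<Rightarrow> real ^ ('k::finite) \<Rightarrow> real) \<Rightarrow> bool" where
  "cocoercive_game l own u \<longleftrightarrow> continuous_game own u \<and>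
     (\<forall>x x'. inner (x' - x) (gradient_field own u x' - gradient_field own u x)
        \<le> - l * (norm (gradient_field own u x' - gradient_field own u x))\<^sup>2)"

section \<open>Martingale difference noise\<close>

text \<open>
  Only \<open>\<xi> t\<close> with \<open>t \<ge> 1\<close> matters. The conditional expectation of a vector is taken
  componentwise. Square integrability is demanded explicitly because the conditional expectation
  and the integral of a non-integrable function have junk values.
\<close>

definition L2_bounded_martingale_difference ::
    "'w measure \<Rightarrow> (nat \<Rightarrow> 'w measure) \<Rightarrow> (nat \<Rightarrow> 'w \<Rightarrow> real ^ ('k::finite)) \<Rightarrow> bool" where
  "L2_bounded_martingale_difference M F \<xi> \<longleftrightarrow>
     (\<forall>t\<ge>1. \<xi> t \<in> borel_measurable (F t)) \<and>
     (\<forall>t\<ge>1. integrable M (\<lambda>\<omega>. (norm (\<xi> t \<omega>))\<^sup>2)) \<and>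
     (\<exists>C. \<forall>t\<ge>1. (LINT \<omega>|M. (norm (\<xi> t \<omega>))\<^sup>2) \<le> C) \<and>
     (\<forall>t k. AE \<omega> in M. real_cond_exp M (F t) (\<lambda>\<omega>'. \<xi> (Suc t) \<omega>' $ k) \<omega> = 0)"

end

theory Submission
  imports Defs
begin

text \<open>
  Cocoercivity makes every payoff concave in the own action, so the Nash equilibria are exactly the
  zeros of \<open>v\<close>. Fix such a zero \<open>p\<close> and let \<open>h t = (norm (x t - p))\<^sup>2\<close>. Expanding the step and using
  cocoercivity at \<open>p\<close> bounds \<open>h (Suc t) - h t\<close> by a martingale difference plus terms of order
  \<open>(\<eta> t)\<^sup>2\<close>, minus \<open>2 \<eta> t l (norm (v (x t)))\<^sup>2\<close>. Taking expectations, a discrete Gronwall argument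
  shows that \<open>h\<close> is bounded in mean and that \<open>\<Sum>t. \<eta> t (norm (v (x t)))\<^sup>2\<close> has finite expectation.
  Hence the martingale has summable variances and converges almost surely, and so does \<open>h\<close>, while
  divergence of \<open>\<Sum>t. \<eta> t\<close> forces \<open>v (x t)\<close> to come arbitrarily close to \<open>0\<close>. By compactness a
  subsequence of \<open>x\<close> converges to a zero of \<open>v\<close>; since the distances to all zeros in a countable
  dense set converge, the whole sequence approaches the set of zeros.
\<close>

section \<open>Real sequences\<close>

text \<open>Subtracting the partial sums of \<open>a\<close> from \<open>h\<close> leaves a
  nonincreasing sequence that is bounded below. The terms \<open>a n\<close> may have either sign,
  so martingale increments can be put there.\<close>

lemma convergent_of_summable_increments:
  fixes h a :: "nat \<Rightarrow> real"
  assumes nonneg: "\<And>n. 0 \<le> h n" and step: "\<And>n. h (Suc n) \<le> h n + a n" and "summable a"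
  shows "convergent h"
proof -
  define g where "g n = h n - (\<Sum>i<n. a i)" for n
  have S: "convergent (\<lambda>n. \<Sum>i<n. a i)"
    using \<open>summable a\<close> summable_iff_convergent by blast
  then obtain K where K: "\<And>n. norm (\<Sum>i<n. a i) \<le> K"
    using convergent_imp_Bseq BseqE by metis
  have "decseq g"
    using step by (intro decseq_SucI) (simp add: g_def algebra_simps)
  moreover have "- K \<le> g n" for n
    using nonneg[of n] K[of n] by (simp add: g_def)
  ultimately obtain L where "g \<longlonglongrightarrow> L"
    using decseq_convergent by metis
  then have "convergent (\<lambda>n. g n + (\<Sum>i<n. a i))"
    using S by (intro convergent_add) (auto simp: convergent_def)
  then show ?thesis by (simp add: g_def)
qed

text \<open>The dissipated amounts \<open>q\<close> stay on the left through the induction, so a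
  single bound yields both the boundedness of \<open>a\<close> and the convergence of the sum of
  \<open>q\<close>.\<close>

lemma discrete_gronwall:
  fixes a b c q :: "nat \<Rightarrow> real"
  assumes nonneg: "\<And>n. 0 \<le> a n" "\<And>n. 0 \<le> b n" "\<And>n. 0 \<le> c n" "\<And>n. 0 \<le> q n"
    and step: "\<And>n. a (Suc n) + q n \<le> (1 + b n) * a n + c n"
    and "summable b" "summable c"
  shows "\<exists>B. \<forall>n. a n \<le> B" and "summable q"
proof -
  define P where "P n = (\<Prod>i<n. 1 + b i)" for n
  have P1: "1 \<le> P n" for n
    unfolding P_def by (rule prod_ge_1) (simp add: nonneg)
  have main: "a n + (\<Sum>i<n. q i) \<le> P n * (a 0 + (\<Sum>i<n. c i))" for n
  proof (induction n)
    case 0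
    then show ?case by (simp add: P_def)
  next
    case (Suc n)
    have Q: "0 \<le> (\<Sum>i<n. q i)" by (simp add: sum_nonneg nonneg)
    have "a (Suc n) + (\<Sum>i<Suc n. q i) \<le> (1 + b n) * a n + (\<Sum>i<n. q i) + c n"
      using step[of n] by simp
    also have "\<dots> \<le> (1 + b n) * (a n + (\<Sum>i<n. q i)) + c n"
      using mult_nonneg_nonneg[OF nonneg(2)[of n] Q] by (simp add: algebra_simps)
    \<comment> \<open>Since \<open>P (Suc n) \<ge> 1\<close>, the new term \<open>c n\<close> may be
      enlarged so that all summands share the factor \<open>P (Suc n)\<close>.\<close>
    also have "\<dots> \<le> (1 + b n) * (P n * (a 0 + (\<Sum>i<n. c i))) + P (Suc n) * c n"
      using Suc.IH nonneg(2)[of n] mult_right_mono[OF P1[of "Suc n"] nonneg(3)[of n]]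
      by (intro add_mono mult_left_mono) auto
    also have "\<dots> = P (Suc n) * (a 0 + (\<Sum>i<Suc n. c i))"
      by (simp add: P_def algebra_simps)
    finally show ?case .
  qed
  define B where "B = exp (suminf b) * (a 0 + suminf c)"
  have "P n \<le> exp (suminf b)" for n
  proof -
    have "P n \<le> (\<Prod>i<n. exp (b i))"
      unfolding P_def by (intro prod_mono) (auto simp: nonneg)
    also have "\<dots> \<le> exp (suminf b)"
      by (simp add: exp_sum[symmetric] sum_le_suminf \<open>summable b\<close> nonneg)
    finally show ?thesis .
  qed
  then have "P n * (a 0 + (\<Sum>i<n. c i)) \<le> B" for n
    unfolding B_def
    by (intro mult_mono add_mono sum_le_suminf \<open>summable c\<close>) (auto simp: nonneg sum_nonneg)
  with main have B: "a n + (\<Sum>i<n. q i) \<le> B" for n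
    by (meson order_trans)
  have "a n \<le> B" for n
    using B[of n] sum_nonneg[of "{..<n}" q] nonneg(4) by simp
  then show "\<exists>B. \<forall>n. a n \<le> B" by blast
  have "(\<Sum>i<n. q i) \<le> B" for n
    using B[of n] nonneg(1)[of n] by simp
  then show "summable q"
    by (intro bounded_imp_summable[of q B]) (auto simp: nonneg lessThan_Suc_atMost[symmetric] simp del: sum.lessThan_Suc)
qed

text \<open>If \<open>f\<close> stayed above \<open>e\<close> from \<open>N\<close> on, then
  \<open>w\<close> would be dominated there by \<open>w * f / e\<close> and would be
  summable.\<close>

lemma frequently_small_of_weighted_summable:
  fixes w f :: "nat \<Rightarrow> real"
  assumes w: "\<And>n. 0 \<le> w n" "\<not> summable w" and "\<And>n. 0 \<le> f n"
    and wf: "summable (\<lambda>n. w n * f n)" and "0 < e"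
  shows "\<exists>n\<ge>N. f n < e"
proof (rule ccontr)
  assume "\<not> ?thesis"
  then have ge: "e \<le> f n" if "N \<le> n" for n
    using that by force
  have "summable (\<lambda>n. w n * f n * (1 / e))"
    using wf by (rule summable_mult2)
  then have "summable w"
  proof (rule summable_comparison_test'[where N = N])
    fix n assume "N \<le> n"
    then show "norm (w n) \<le> w n * f n * (1 / e)"
      using mult_left_mono[OF ge w(1), of n n] \<open>0 < e\<close> w(1)[of n] by (simp add: field_simps)
  qed
  with w(2) show False ..
qed

section \<open>Sums of square integrable orthogonal increments\<close>

lemma integrable_mult_L2:
  fixes f g :: "'a \<Rightarrow> real"
  assumes [measurable]: "f \<in> borel_measurable M" "g \<in> borel_measurable M"
    and "integrable M (\<lambda>x. (f x)\<^sup>2)" "integrable M (\<lambda>x. (g x)\<^sup>2)"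
  shows "integrable M (\<lambda>x. f x * g x)"
proof (rule Bochner_Integration.integrable_bound)
  show "integrable M (\<lambda>x. (f x)\<^sup>2 + (g x)\<^sup>2)" using assms by simp
  have "\<bar>a * b\<bar> \<le> a\<^sup>2 + b\<^sup>2" for a b :: real
  proof -
    have "2 * (\<bar>a\<bar> * \<bar>b\<bar>) \<le> a\<^sup>2 + b\<^sup>2"
      using sum_squares_bound[of "\<bar>a\<bar>" "\<bar>b\<bar>"] by simp
    moreover have "0 \<le> \<bar>a\<bar> * \<bar>b\<bar>" by simp
    ultimately show ?thesis by (simp only: abs_mult)
  qed
  then show "AE x in M. norm (f x * g x) \<le> norm ((f x)\<^sup>2 + (g x)\<^sup>2)"
    by (auto intro!: AE_I2)
qed measurable

text \<open>By monotone convergence the pointwise sum has finite expectation, hence is finite almost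
  everywhere.\<close>

lemma AE_summable_of_summable_integral:
  fixes f :: "nat \<Rightarrow> 'a \<Rightarrow> real"
  assumes int: "\<And>n. integrable M (f n)" and nonneg: "\<And>n x. 0 \<le> f n x"
    and "summable (\<lambda>n. LINT x|M. f n x)"
  shows "AE x in M. summable (\<lambda>n. f n x)"
proof -
  have [measurable]: "f n \<in> borel_measurable M" for n using int by simp
  have "(\<integral>\<^sup>+ x. (\<Sum>n. ennreal (f n x)) \<partial>M) = (\<Sum>n. \<integral>\<^sup>+ x. ennreal (f n x) \<partial>M)"
    by (rule nn_integral_suminf) simp
  also have "\<dots> = (\<Sum>n. ennreal (LINT x|M. f n x))"
    by (simp add: nn_integral_eq_integral int nonneg)
  also have "\<dots> = ennreal (\<Sum>n. LINT x|M. f n x)"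
    by (intro suminf_ennreal2 assms integral_nonneg_AE) (simp add: nonneg)
  finally have "(\<integral>\<^sup>+ x. (\<Sum>n. ennreal (f n x)) \<partial>M) \<noteq> \<infinity>" by simp
  then have "AE x in M. (\<Sum>n. ennreal (f n x)) \<noteq> \<infinity>"
    by (intro nn_integral_PInf_AE) auto
  then show ?thesis
    by eventually_elim (use nonneg summable_suminf_not_top in auto)
qed

text \<open>
  Freezing the partial sums once they reach level \<open>e\<close> turns the maximal inequality into Markov's
  inequality for a single sum, which is still a sum of orthogonal increments.
\<close>

primrec stopped_sum :: "real \<Rightarrow> (nat \<Rightarrow> real) \<Rightarrow> nat \<Rightarrow> real" where
  "stopped_sum e d 0 = 0"
| "stopped_sum e d (Suc n) = stopped_sum e d n + (if \<bar>stopped_sum e d n\<bar> < e then d n else 0)"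

text \<open>Used to return from stopped to true sums: on a path where the stopped sums never reach
  \<open>e\<close>, nothing was ever frozen.\<close>

lemma stopped_sum_cases:
  "e \<le> \<bar>stopped_sum e d n\<bar> \<or>
    (stopped_sum e d n = (\<Sum>j<n. d j) \<and> (\<forall>k\<le>n. \<bar>\<Sum>j<k. d j\<bar> < e))"
  by (induction n) (auto simp: le_Suc_eq not_less)

lemma stopped_sum_large_mono:
  assumes "m \<le> n" and "e \<le> \<bar>stopped_sum e d m\<bar>"
  shows "e \<le> \<bar>stopped_sum e d n\<bar>"
  using assms by (induction n rule: dec_induct) auto

lemma summable_of_small_tail_sums:
  fixes d :: "nat \<Rightarrow> real"
  assumes "\<And>k::nat. \<exists>m. \<forall>n. \<bar>\<Sum>j<n. d (m + j)\<bar> < 1 / Suc k"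
  shows "summable d"
  unfolding summable_Cauchy
proof (intro allI impI)
  fix e :: real assume "0 < e"
  \<comment> \<open>A block sum over \<open>{a..<b}\<close> is the difference of two sums starting
    at \<open>m\<close>, hence the half of \<open>e\<close>.\<close>
  then obtain k where k: "1 / Suc k < e / 2"
    using nat_approx_posE[of "e / 2"] by auto
  obtain m where m: "\<And>n. \<bar>\<Sum>j<n. d (m + j)\<bar> < 1 / Suc k"
    using assms by blast
  have S: "(\<Sum>j<n - m. d (m + j)) = sum d {m..<n}" if "m \<le> n" for n
    using that by (intro sum.reindex_bij_witness[of _ "\<lambda>j. j - m" "\<lambda>j. m + j"]) auto
  have "norm (sum d {a..<b}) < e" if "m \<le> a" for a b
  proof (cases "a \<le> b")
    case True
    have "sum d {m..<b} = sum d {m..<a} + sum d {a..<b}"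
      using that True by (simp add: sum.atLeastLessThan_concat)
    then show ?thesis
      using m[of "a - m"] m[of "b - m"] S[of a] S[of b] that True k by simp
  qed (use \<open>0 < e\<close> in simp)
  then show "\<exists>N. \<forall>m\<ge>N. \<forall>n. norm (sum d {m..<n}) < e" by blast
qed

text \<open>The weak form of a martingale difference: instead of a vanishing conditional mean given
  \<open>F t\<close>, \<open>d t\<close> is orthogonal to every square integrable variable known at
  time \<open>t\<close>.\<close>

locale orthogonal_increments = prob_space M
  for M :: "'w measure" and F :: "nat \<Rightarrow> 'w measure" and d :: "nat \<Rightarrow> 'w \<Rightarrow> real" +
  assumes subalg_M: "\<And>t. subalgebra M (F t)"
    and subalg_mono: "\<And>s t. s \<le> t \<Longrightarrow> subalgebra (F t) (F s)"
    and adapted: "\<And>t. d t \<in> borel_measurable (F (Suc t))"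
    and L2: "\<And>t. integrable M (\<lambda>\<omega>. (d t \<omega>)\<^sup>2)"
    and orthogonal: "\<And>t Z. Z \<in> borel_measurable (F t) \<Longrightarrow> integrable M (\<lambda>\<omega>. (Z \<omega>)\<^sup>2) \<Longrightarrow>
          (LINT \<omega>|M. Z \<omega> * d t \<omega>) = 0"
begin

lemma d_measurable [measurable]: "d t \<in> borel_measurable M"
  using measurable_from_subalg[OF subalg_M adapted] .

abbreviation T :: "real \<Rightarrow> nat \<Rightarrow> nat \<Rightarrow> 'w \<Rightarrow> real" where
  "T e m n \<omega> \<equiv> stopped_sum e (\<lambda>j. d (m + j) \<omega>) n"

lemma stopped_measurable_F: "T e m n \<in> borel_measurable (F (m + n))"
proof (induction n)
  case (Suc n)
  have [measurable]: "T e m n \<in> borel_measurable (F (Suc (m + n)))"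
    by (rule measurable_from_subalg[OF subalg_mono Suc]) simp
  have [measurable]: "d (m + n) \<in> borel_measurable (F (Suc (m + n)))"
    by (rule adapted)
  show ?case by simp
qed simp

lemma stopped_measurable [measurable]: "T e m n \<in> borel_measurable M"
  by (rule measurable_from_subalg[OF subalg_M stopped_measurable_F])

text \<open>Pythagoras: the cross term vanishes by orthogonality, and stopping can only shrink the
  square of each increment.\<close>

lemma stopped_L2:
  "integrable M (\<lambda>\<omega>. (T e m n \<omega>)\<^sup>2)"
  "(LINT \<omega>|M. (T e m n \<omega>)\<^sup>2) \<le> (\<Sum>j<n. LINT \<omega>|M. (d (m + j) \<omega>)\<^sup>2)"
proof (induction n)
  case (Suc n)
  \<comment> \<open>Indicator that the sum is not yet frozen. It is known at time
    \<open>m + n\<close>, so \<open>T e m n * I\<close> is an admissible test variable against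
    \<open>d (m + n)\<close>.\<close>
  define I where "I \<omega> = (if \<bar>T e m n \<omega>\<bar> < e then 1 else 0::real)" for \<omega>
  have [measurable]: "T e m n \<in> borel_measurable (F (m + n))"
    by (rule stopped_measurable_F)
  have [measurable]: "I \<in> borel_measurable (F (m + n))"
    unfolding I_def by measurable
  have [measurable]: "I \<in> borel_measurable M"
    unfolding I_def by measurable
  have I: "(I \<omega>)\<^sup>2 = I \<omega>" "0 \<le> I \<omega>" "I \<omega> \<le> 1" for \<omega> by (auto simp: I_def)
  have step: "T e m (Suc n) \<omega> = T e m n \<omega> + I \<omega> * d (m + n) \<omega>" for \<omega> by (simp add: I_def)
  have sq: "(T e m (Suc n) \<omega>)\<^sup>2 =
      (T e m n \<omega>)\<^sup>2 + (I \<omega> * d (m + n) \<omega>)\<^sup>2 + 2 * ((T e m n \<omega> * I \<omega>) * d (m + n) \<omega>)" for \<omega>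
    unfolding step by (simp add: power2_sum)
  have le: "(I \<omega> * y)\<^sup>2 \<le> y\<^sup>2" for y \<omega>
    using I[of \<omega>] by (auto simp: power_mult_distrib intro: mult_left_le_one_le)
  have i1: "integrable M (\<lambda>\<omega>. (I \<omega> * d (m + n) \<omega>)\<^sup>2)"
    by (rule Bochner_Integration.integrable_bound[OF L2[of "m + n"]]) (auto simp: le)
  have i2: "integrable M (\<lambda>\<omega>. (T e m n \<omega> * I \<omega>)\<^sup>2)"
    by (rule Bochner_Integration.integrable_bound[OF Suc.IH(1)])
      (use le[of _ "T e m n _"] in \<open>auto simp: mult.commute\<close>)
  have i3: "integrable M (\<lambda>\<omega>. (T e m n \<omega> * I \<omega>) * d (m + n) \<omega>)"
    using i2 L2 by (intro integrable_mult_L2) auto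
  have z: "(LINT \<omega>|M. (T e m n \<omega> * I \<omega>) * d (m + n) \<omega>) = 0"
    using i2 by (intro orthogonal) measurable
  show "integrable M (\<lambda>\<omega>. (T e m (Suc n) \<omega>)\<^sup>2)"
    unfolding sq using Suc.IH(1) i1 i3 by simp
  have "(LINT \<omega>|M. (T e m (Suc n) \<omega>)\<^sup>2) =
      (LINT \<omega>|M. (T e m n \<omega>)\<^sup>2) + (LINT \<omega>|M. (I \<omega> * d (m + n) \<omega>)\<^sup>2)"
    unfolding sq using Suc.IH(1) i1 i3 z by simp
  also have "\<dots> \<le> (\<Sum>j<n. LINT \<omega>|M. (d (m + j) \<omega>)\<^sup>2) + (LINT \<omega>|M. (d (m + n) \<omega>)\<^sup>2)"
    by (intro add_mono Suc.IH(2) integral_mono i1 L2 le)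
  finally show "(LINT \<omega>|M. (T e m (Suc n) \<omega>)\<^sup>2) \<le> (\<Sum>j<Suc n. LINT \<omega>|M. (d (m + j) \<omega>)\<^sup>2)"
    by simp
qed auto

lemma maximal_inequality:
  assumes "0 < e" and summ: "summable (\<lambda>t. LINT \<omega>|M. (d t \<omega>)\<^sup>2)"
  shows "prob (\<Union>n. {\<omega> \<in> space M. e \<le> \<bar>T e m n \<omega>\<bar>}) \<le> (\<Sum>j. LINT \<omega>|M. (d (j + m) \<omega>)\<^sup>2) / e\<^sup>2"
proof -
  let ?A = "\<lambda>n. {\<omega> \<in> space M. e \<le> \<bar>T e m n \<omega>\<bar>}"
  \<comment> \<open>Freezing makes these events increase with \<open>n\<close>, so a bound uniform
    in \<open>n\<close> passes to the union.\<close>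
  have "(\<lambda>n. prob (?A n)) \<longlonglongrightarrow> prob (\<Union>n. ?A n)"
    by (intro finite_Lim_measure_incseq) (auto simp: incseq_def stopped_sum_large_mono)
  moreover have "prob (?A n) \<le> (\<Sum>j. LINT \<omega>|M. (d (j + m) \<omega>)\<^sup>2) / e\<^sup>2" for n
  proof -
    have "?A n = {\<omega> \<in> space M. e\<^sup>2 \<le> (T e m n \<omega>)\<^sup>2}"
      using \<open>0 < e\<close> abs_le_square_iff[of e] by auto
    also have "prob \<dots> \<le> (LINT \<omega>|M. (T e m n \<omega>)\<^sup>2) / e\<^sup>2"
      using \<open>0 < e\<close> by (intro integral_Markov_inequality_measure[OF stopped_L2(1), of "{}"]) auto
    also have "\<dots> \<le> (\<Sum>j<n. LINT \<omega>|M. (d (j + m) \<omega>)\<^sup>2) / e\<^sup>2"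
      using stopped_L2(2)[of e m n] by (intro divide_right_mono) (simp_all add: add.commute)
    also have "\<dots> \<le> (\<Sum>j. LINT \<omega>|M. (d (j + m) \<omega>)\<^sup>2) / e\<^sup>2"
      using summable_ignore_initial_segment[OF summ, of m]
      by (intro divide_right_mono sum_le_suminf) auto
    finally show ?thesis .
  qed
  ultimately show ?thesis
    by (intro LIMSEQ_le_const2) auto
qed

proposition AE_summable_increments:
  assumes summ: "summable (\<lambda>t. LINT \<omega>|M. (d t \<omega>)\<^sup>2)"
  shows "AE \<omega> in M. summable (\<lambda>t. d t \<omega>)"
proof -
  have *: "AE \<omega> in M. \<exists>m. \<forall>n. \<bar>\<Sum>j<n. d (m + j) \<omega>\<bar> < e" if "0 < e" for e
  proof -
    \<comment> \<open>On \<open>N\<close> the sums reach \<open>e\<close> from every starting index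
      \<open>m\<close>. Its probability is below every tail of the variance series divided by the
      square of \<open>e\<close>, hence zero.\<close>
    define N where "N = (\<Inter>m. \<Union>n. {\<omega> \<in> space M. e \<le> \<bar>T e m n \<omega>\<bar>})"
    have N[measurable]: "N \<in> sets M" unfolding N_def by measurable
    have "prob N \<le> (\<Sum>j. LINT \<omega>|M. (d (j + m) \<omega>)\<^sup>2) / e\<^sup>2" for m
    proof -
      have "prob N \<le> prob (\<Union>n. {\<omega> \<in> space M. e \<le> \<bar>T e m n \<omega>\<bar>})"
        unfolding N_def by (intro finite_measure_mono) auto
      also note maximal_inequality[OF \<open>0 < e\<close> summ]
      finally show ?thesis .
    qed
    moreover have "(\<lambda>m. (\<Sum>j. LINT \<omega>|M. (d (j + m) \<omega>)\<^sup>2) / e\<^sup>2) \<longlonglongrightarrow> 0 / e\<^sup>2"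
      using suminf_exist_split2[OF summ] by (intro tendsto_divide tendsto_const) (use \<open>0 < e\<close> in auto)
    ultimately have "prob N \<le> 0"
      using LIMSEQ_le_const[of _ "0 / e\<^sup>2" "prob N"] by auto
    then have "prob N = 0"
      using measure_nonneg[of M N] by linarith
    then have "AE \<omega> in M. \<omega> \<notin> N"
      using prob_eq_0[OF N] by simp
    then show ?thesis
    proof (rule AE_mp, intro AE_I2 impI)
      fix \<omega> assume "\<omega> \<in> space M" "\<omega> \<notin> N"
      then obtain m where "\<And>n. \<not> e \<le> \<bar>T e m n \<omega>\<bar>" by (auto simp: N_def)
      then have "\<bar>\<Sum>j<n. d (m + j) \<omega>\<bar> < e" for n
        using stopped_sum_cases[of e "\<lambda>j. d (m + j) \<omega>" n] by blast
      then show "\<exists>m. \<forall>n. \<bar>\<Sum>j<n. d (m + j) \<omega>\<bar> < e" by blast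
    qed
  qed
  \<comment> \<open>Only the levels \<open>1 / Suc k\<close> are used, so that the exceptional sets
    have a null union.\<close>
  have "AE \<omega> in M. \<forall>k::nat. \<exists>m. \<forall>n. \<bar>\<Sum>j<n. d (m + j) \<omega>\<bar> < 1 / Suc k"
    unfolding AE_all_countable by (intro allI *) simp
  then show ?thesis
    by eventually_elim (rule summable_of_small_tail_sums, blast)
qed

end

section \<open>Cocoercive games\<close>

text \<open>Cauchy-Schwarz bounds the inner product from below; one factor
  \<open>norm (v x' - v x)\<close> then cancels.\<close>

lemma cocoercive_lipschitz:
  fixes v :: "'a::real_inner \<Rightarrow> 'a"
  assumes "0 < l"
    and "\<And>x x'. inner (x' - x) (v x' - v x) \<le> - l * (norm (v x' - v x))\<^sup>2"
  shows "norm (v x' - v x) \<le> norm (x' - x) / l"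
proof -
  let ?n = "norm (v x' - v x)"
  have "- (norm (x' - x) * ?n) \<le> inner (x' - x) (v x' - v x)"
    using Cauchy_Schwarz_ineq2[of "x' - x" "v x' - v x"] by linarith
  with assms(2)[of x' x] have "(l * ?n) * ?n \<le> norm (x' - x) * ?n"
    by (simp add: power2_eq_square mult.assoc)
  then have "l * ?n \<le> norm (x' - x)"
    by (cases "?n = 0") (simp_all add: mult_le_cancel_right)
  then show ?thesis
    using \<open>0 < l\<close> by (simp add: field_simps)
qed

lemma deviate_self [simp]: "deviate own i x x = x"
  by (simp add: deviate_def vec_eq_iff)

text \<open>First-order condition, player by player: deviating to \<open>x\<close> itself changes
  nothing, so \<open>x\<close> is an unconstrained maximiser of each payoff in the own
  action.\<close>

lemma gradient_field_eq_0_if_nash: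
  assumes "continuous_game own u" and nash: "x \<in> nash_equilibria own u"
  shows "gradient_field own u x = 0"
proof -
  have "partial_gradient own i (u i) x = 0" for i
  proof -
    let ?f = "\<lambda>y. u i (deviate own i y x)"
    obtain g where g: "GDERIV ?f x :> g"
      using assms(1) unfolding continuous_game_def by blast
    have "(\<lambda>h. inner h g) = (\<lambda>h. 0)"
      using g nash unfolding gderiv_def nash_equilibria_def
      by (intro differential_zero_maxmin[of x UNIV ?f]) auto
    then have "inner g g = 0" by meson
    then show ?thesis using partial_gradient_eqI[OF g] by simp
  qed
  then show ?thesis by (simp add: gradient_field_def vec_eq_iff)
qed

text \<open>Restricted to the segment towards a unilateral deviation, monotonicity of the field makes
  the payoff of the deviating player nonincreasing.\<close>

lemma nash_if_gradient_field_eq_0: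
  assumes game: "continuous_game own u"
    and mono: "\<And>x x'. inner (x' - x) (gradient_field own u x' - gradient_field own u x) \<le> 0"
    and zero: "gradient_field own u x = 0"
  shows "x \<in> nash_equilibria own u"
proof -
  have "u i (deviate own i y x) \<le> u i x" for i y
  proof -
    define \<delta> where "\<delta> = deviate own i y x - x"
    define z where "z s = x + s *\<^sub>R \<delta>" for s :: real
    have \<delta>: "own k \<noteq> i \<Longrightarrow> \<delta> $ k = 0" for k by (simp add: \<delta>_def deviate_def)
    \<comment> \<open>The segment moves only in block \<open>i\<close>, so along it the payoff is
      differentiated by the own-action gradient alone.\<close>
    have dev: "deviate own i (z r) (z s) = z r" for r s
      using \<delta> by (auto simp: deviate_def z_def vec_eq_iff)
    have D: "((\<lambda>r. u i (z r)) has_real_derivative inner \<delta> (gradient_field own u (z s))) (at s)" for s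
    proof -
      obtain g where g: "GDERIV (\<lambda>y. u i (deviate own i y (z s))) (z s) :> g"
        using game unfolding continuous_game_def by blast
      have "(z has_derivative (\<lambda>r. r *\<^sub>R \<delta>)) (at s)"
        unfolding z_def by (auto intro!: derivative_eq_intros)
      from has_derivative_compose[OF this g[unfolded gderiv_def]]
      have "((\<lambda>r. u i (z r)) has_real_derivative inner \<delta> g) (at s)"
        by (simp add: dev has_field_derivative_def mult.commute[of _ "inner \<delta> g"] mult_commute_abs)
      also have "inner \<delta> g = inner \<delta> (gradient_field own u (z s))"
        unfolding inner_vec_def
      proof (rule sum.cong[OF refl])
        fix k
        show "inner (\<delta> $ k) (g $ k) = inner (\<delta> $ k) (gradient_field own u (z s) $ k)"
          using \<delta>[of k]
          by (cases "own k = i") (auto simp: gradient_field_def partial_gradient_eqI[OF g])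
      qed
      finally show ?thesis .
    qed
    have "inner \<delta> (gradient_field own u (z s)) \<le> 0" if "0 \<le> s" for s
    proof (cases "s = 0")
      case False
      then show ?thesis
        \<comment> \<open>Here \<open>z s - x\<close> is \<open>s\<close> times
          \<open>\<delta>\<close> and the field vanishes at \<open>x\<close>, so the positive factor
          \<open>s\<close> can be divided out.\<close>
        using mono[of "z s" x] that by (simp add: z_def zero mult_le_0_iff)
    qed (simp add: z_def zero)
    with D have "u i (z 1) \<le> u i (z 0)"
      by (intro DERIV_nonpos_imp_nonincreasing[of 0 1 "\<lambda>r. u i (z r)"]) (simp, blast)
    then show ?thesis by (simp add: z_def \<delta>_def)
  qed
  then show ?thesis by (simp add: nash_equilibria_def)
qed

section \<open>Stochastic iterations with a cocoercive field\<close>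

text \<open>Times are shifted: \<open>\<eta> t\<close> and \<open>\<xi> t\<close> drive the step
  from \<open>x t\<close> to \<open>x (Suc t)\<close>, so \<open>\<xi> t\<close> is known at time
  \<open>Suc t\<close> and centred given \<open>F t\<close>. The constants \<open>s\<close> and
  \<open>C\<close> bound its conditional and its unconditional second moment.\<close>

locale cocoercive_iteration = prob_space M
  for M :: "'w measure" +
  fixes F :: "nat \<Rightarrow> 'w measure"
    and v :: "real ^ 'k::finite \<Rightarrow> real ^ 'k" and l :: real
    and x \<xi> :: "nat \<Rightarrow> 'w \<Rightarrow> real ^ 'k" and x0 :: "real ^ 'k"
    and \<eta> :: "nat \<Rightarrow> real" and s C :: real
  assumes l_pos: "0 < l"
    and cocoercive: "\<And>y y'. inner (y' - y) (v y' - v y) \<le> - l * (norm (v y' - v y))\<^sup>2"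
    and subalg_M: "\<And>t. subalgebra M (F t)"
    and subalg_mono: "\<And>s t. s \<le> t \<Longrightarrow> subalgebra (F t) (F s)"
    and x_adapted: "\<And>t. x t \<in> borel_measurable (F t)"
    and x_init: "\<And>\<omega>. \<omega> \<in> space M \<Longrightarrow> x 0 \<omega> = x0"
    and x_step: "\<And>t \<omega>. \<omega> \<in> space M \<Longrightarrow>
          x (Suc t) \<omega> = x t \<omega> + \<eta> t *\<^sub>R (v (x t \<omega>) + \<xi> t \<omega>)"
    and \<xi>_adapted: "\<And>t. \<xi> t \<in> borel_measurable (F (Suc t))"
    and \<xi>_L2: "\<And>t. integrable M (\<lambda>\<omega>. (norm (\<xi> t \<omega>))\<^sup>2)"
    and \<xi>_bound: "\<And>t. (LINT \<omega>|M. (norm (\<xi> t \<omega>))\<^sup>2) \<le> C"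
    and \<xi>_mean: "\<And>t k. AE \<omega> in M. real_cond_exp M (F t) (\<lambda>\<omega>'. \<xi> t \<omega>' $ k) \<omega> = 0"
    and \<xi>_cond_bound: "\<And>t. AE \<omega> in M. real_cond_exp M (F t) (\<lambda>\<omega>'. (norm (\<xi> t \<omega>'))\<^sup>2) \<omega> \<le> s"
    and s_nonneg: "0 \<le> s"
    and \<eta>_pos: "\<And>t. 0 < \<eta> t"
    and \<eta>_not_summable: "\<not> summable \<eta>"
    and \<eta>_square_summable: "summable (\<lambda>t. (\<eta> t)\<^sup>2)"
begin

lemma sigma_finite_F: "sigma_finite_subalgebra M (F t)"
  by (intro finite_measure_subalgebra_is_sigma_finite finite_measure_subalgebra.intro
      finite_measure_subalgebra_axioms.intro subalg_M finite_measure_axioms)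

lemma v_lipschitz: "norm (v y' - v y) \<le> norm (y' - y) / l"
  using l_pos cocoercive by (rule cocoercive_lipschitz)

lemma v_continuous: "continuous_on UNIV v"
proof -
  have "lipschitz_on (1 / l) UNIV v"
    using v_lipschitz l_pos by (intro lipschitz_onI) (auto simp: dist_norm)
  then show ?thesis by (rule lipschitz_on_continuous_on)
qed

lemma v_measurable [measurable]: "v \<in> borel_measurable borel"
  using v_continuous by (rule borel_measurable_continuous_onI)

lemma x_measurable [measurable]: "x t \<in> borel_measurable M"
  by (rule measurable_from_subalg[OF subalg_M x_adapted])

lemma \<xi>_measurable [measurable]: "\<xi> t \<in> borel_measurable M"
  by (rule measurable_from_subalg[OF subalg_M \<xi>_adapted])

text \<open>Integrability of the product is part of the claim, so \<open>h\<close> is pulled out of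
  the nonnegative conditional expectation, where no integrability is required beforehand.\<close>

lemma integrable_weighted_noise:
  assumes h: "h \<in> borel_measurable (F t)" "integrable M h" "\<And>\<omega>. 0 \<le> h \<omega>"
  shows "integrable M (\<lambda>\<omega>. h \<omega> * (norm (\<xi> t \<omega>))\<^sup>2)"
    and "(LINT \<omega>|M. h \<omega> * (norm (\<xi> t \<omega>))\<^sup>2) \<le> s * (LINT \<omega>|M. h \<omega>)"
proof -
  interpret S: sigma_finite_subalgebra M "F t" by (rule sigma_finite_F)
  define g where "g \<omega> = (norm (\<xi> t \<omega>))\<^sup>2" for \<omega>
  have [measurable]: "g \<in> borel_measurable M" unfolding g_def by measurable
  have [measurable]: "h \<in> borel_measurable M" using h(2) by simp
  have g0: "0 \<le> g \<omega>" for \<omega> by (simp add: g_def)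
  \<comment> \<open>\<open>enn2real\<close> sends infinity to 0, so the bound on
    \<open>real_cond_exp\<close> transfers to \<open>nn_cond_exp\<close> only once the latter is
    known to be finite.\<close>
  have "(\<integral>\<^sup>+ \<omega>. nn_cond_exp M (F t) g \<omega> \<partial>M) = (\<integral>\<^sup>+ \<omega>. ennreal (g \<omega>) \<partial>M)"
    using S.nn_cond_exp_intg[of "\<lambda>_. 1" g] by simp
  also have "\<dots> \<noteq> \<infinity>"
    using \<xi>_L2[of t] g0 by (simp add: nn_integral_eq_integral g_def)
  finally have fin: "AE \<omega> in M. nn_cond_exp M (F t) g \<omega> \<noteq> \<infinity>"
    by (intro nn_integral_PInf_AE) auto
  \<comment> \<open>\<open>real_cond_exp\<close> subtracts the contribution of the negative part,
    which is zero here.\<close>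
  have neg: "AE \<omega> in M. nn_cond_exp M (F t) (\<lambda>\<omega>. ennreal (- g \<omega>)) \<omega> = 0"
    using S.nn_cond_exp_F_meas[of "\<lambda>_. 0"] g0 by (auto simp: ennreal_neg elim!: eventually_mono)
  have le: "AE \<omega> in M. nn_cond_exp M (F t) g \<omega> \<le> ennreal s"
    using fin neg \<xi>_cond_bound[of t]
    by eventually_elim (auto simp: real_cond_exp_def g_def[symmetric] enn2real_le)
  have "(\<integral>\<^sup>+ \<omega>. ennreal (h \<omega> * g \<omega>) \<partial>M) = (\<integral>\<^sup>+ \<omega>. ennreal (h \<omega>) * nn_cond_exp M (F t) g \<omega> \<partial>M)"
    using S.nn_cond_exp_intg[of "\<lambda>\<omega>. ennreal (h \<omega>)" g] h(1) by (simp add: ennreal_mult h(3) g0)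
  also have "\<dots> \<le> (\<integral>\<^sup>+ \<omega>. ennreal (h \<omega>) * ennreal s \<partial>M)"
    using le by (intro nn_integral_mono_AE) (auto elim!: eventually_mono intro: mult_left_mono)
  also have "\<dots> = ennreal (s * (LINT \<omega>|M. h \<omega>))"
    using h by (subst nn_integral_multc)
      (simp_all add: nn_integral_eq_integral ennreal_mult' mult.commute s_nonneg)
  finally have nn: "(\<integral>\<^sup>+ \<omega>. ennreal (h \<omega> * g \<omega>) \<partial>M) \<le> ennreal (s * (LINT \<omega>|M. h \<omega>))" .
  have I: "integrable M (\<lambda>\<omega>. h \<omega> * g \<omega>)"
    using nn by (intro integrableI_nonneg) (auto simp: h(3) g0 intro: le_less_trans)
  have "ennreal (LINT \<omega>|M. h \<omega> * g \<omega>) \<le> ennreal (s * (LINT \<omega>|M. h \<omega>))"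
    using nn by (simp add: nn_integral_eq_integral I h(3) g0)
  then have "(LINT \<omega>|M. h \<omega> * g \<omega>) \<le> s * (LINT \<omega>|M. h \<omega>)"
    by (subst (asm) ennreal_le_iff) (auto intro!: mult_nonneg_nonneg s_nonneg integral_nonneg_AE simp: h(3))
  with I show "integrable M (\<lambda>\<omega>. h \<omega> * (norm (\<xi> t \<omega>))\<^sup>2)"
    and "(LINT \<omega>|M. h \<omega> * (norm (\<xi> t \<omega>))\<^sup>2) \<le> s * (LINT \<omega>|M. h \<omega>)"
    by (simp_all add: g_def)
qed

text \<open>Componentwise, \<open>Z * w $ k\<close> is pulled out of the conditional expectation.
  The product with the noise is integrable because both \<open>Z\<close> and
  \<open>w $ k * \<xi> t $ k\<close> are square integrable, the latter by
  \<open>integrable_weighted_noise\<close>.\<close>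

lemma noise_orthogonal:
  fixes w :: "'w \<Rightarrow> real ^ 'k"
  assumes w: "w \<in> borel_measurable (F t)" "integrable M (\<lambda>\<omega>. (norm (w \<omega>))\<^sup>2)"
    and Z: "Z \<in> borel_measurable (F t)" "integrable M (\<lambda>\<omega>. (Z \<omega>)\<^sup>2)"
  shows "(LINT \<omega>|M. Z \<omega> * inner (w \<omega>) (\<xi> t \<omega>)) = 0"
proof -
  interpret S: sigma_finite_subalgebra M "F t" by (rule sigma_finite_F)
  have [measurable]: "w \<in> borel_measurable (F t)" "Z \<in> borel_measurable (F t)" by fact+
  have [measurable]: "w \<in> borel_measurable M" "Z \<in> borel_measurable M"
    by (rule measurable_from_subalg[OF subalg_M w(1)]) (rule measurable_from_subalg[OF subalg_M Z(1)])
  have comp [measurable]: "(\<lambda>\<omega>. f \<omega> $ k) \<in> borel_measurable N"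
    if "f \<in> borel_measurable N" for f :: "'w \<Rightarrow> real ^ 'k" and N k
    by (rule measurable_compose[OF that])
      (intro borel_measurable_continuous_onI continuous_intros)
  have I2: "integrable M (\<lambda>\<omega>. (norm (w \<omega>))\<^sup>2 * (norm (\<xi> t \<omega>))\<^sup>2)"
    using w(2) by (intro integrable_weighted_noise) auto
  have I: "integrable M (\<lambda>\<omega>. (Z \<omega> * w \<omega> $ k) * \<xi> t \<omega> $ k)" for k
  proof -
    have "integrable M (\<lambda>\<omega>. (w \<omega> $ k * \<xi> t \<omega> $ k)\<^sup>2)"
    proof (rule Bochner_Integration.integrable_bound[OF I2])
      have "(w \<omega> $ k * \<xi> t \<omega> $ k)\<^sup>2 \<le> (norm (w \<omega>))\<^sup>2 * (norm (\<xi> t \<omega>))\<^sup>2" for \<omega>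
        unfolding power_mult_distrib
        by (intro mult_mono) (auto simp: component_le_norm_cart abs_le_square_iff[symmetric])
      then show "AE \<omega> in M. norm ((w \<omega> $ k * \<xi> t \<omega> $ k)\<^sup>2) \<le> norm ((norm (w \<omega>))\<^sup>2 * (norm (\<xi> t \<omega>))\<^sup>2)"
        by (intro AE_I2) simp
    qed measurable
    then have "integrable M (\<lambda>\<omega>. Z \<omega> * (w \<omega> $ k * \<xi> t \<omega> $ k))"
      using Z(2) by (intro integrable_mult_L2) measurable
    then show ?thesis by (simp add: mult.assoc)
  qed
  have "(LINT \<omega>|M. (Z \<omega> * w \<omega> $ k) * \<xi> t \<omega> $ k) = 0" for k
  proof -
    have "(LINT \<omega>|M. (Z \<omega> * w \<omega> $ k) * \<xi> t \<omega> $ k) =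
        (LINT \<omega>|M. (Z \<omega> * w \<omega> $ k) * real_cond_exp M (F t) (\<lambda>\<omega>'. \<xi> t \<omega>' $ k) \<omega>)"
      by (rule S.real_cond_exp_intg(2)[symmetric, OF I]) measurable
    also have "\<dots> = (LINT \<omega>|M. 0)"
      using \<xi>_mean[of t k] by (intro integral_cong_AE) (auto elim!: eventually_mono)
    finally show ?thesis by simp
  qed
  then have "(LINT \<omega>|M. (\<Sum>k\<in>UNIV. (Z \<omega> * w \<omega> $ k) * \<xi> t \<omega> $ k)) = 0"
    using I by (simp add: Bochner_Integration.integral_sum)
  then show ?thesis
    by (simp add: inner_vec_def sum_distrib_left mult.assoc)
qed

text \<open>The term \<open>2 (\<eta> t)\<^sup>2 (norm (v (x t)))\<^sup>2\<close> is not absorbed into the last one because \<open>\<eta> t\<close> may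
  initially exceed \<open>l\<close>.\<close>

lemma distance_step:
  assumes "v p = 0" and "\<omega> \<in> space M"
  shows "(norm (x (Suc t) \<omega> - p))\<^sup>2 \<le> (norm (x t \<omega> - p))\<^sup>2
    + 2 * \<eta> t * inner (x t \<omega> - p) (\<xi> t \<omega>)
    + 2 * (\<eta> t)\<^sup>2 * (norm (v (x t \<omega>)))\<^sup>2 + 2 * (\<eta> t)\<^sup>2 * (norm (\<xi> t \<omega>))\<^sup>2
    - 2 * \<eta> t * l * (norm (v (x t \<omega>)))\<^sup>2"
proof -
  define a b c where "a = x t \<omega> - p" and "b = v (x t \<omega>)" and "c = \<xi> t \<omega>"
  have "x (Suc t) \<omega> - p = a + \<eta> t *\<^sub>R (b + c)"
    using x_step[OF assms(2)] by (simp add: a_def b_def c_def)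
  then have "(norm (x (Suc t) \<omega> - p))\<^sup>2 =
      (norm a)\<^sup>2 + 2 * \<eta> t * inner a b + 2 * \<eta> t * inner a c + (\<eta> t)\<^sup>2 * (norm (b + c))\<^sup>2"
    unfolding power2_norm_eq_inner
    by (simp add: inner_add_left inner_add_right inner_commute power2_eq_square algebra_simps)
  moreover have "inner a b \<le> - l * (norm b)\<^sup>2"
    using cocoercive[of "x t \<omega>" p] by (simp add: a_def b_def assms(1))
  then have "2 * \<eta> t * inner a b \<le> 2 * \<eta> t * (- l * (norm b)\<^sup>2)"
    using \<eta>_pos[of t] by (intro mult_left_mono) auto
  moreover have "(norm (b + c))\<^sup>2 \<le> 2 * (norm b)\<^sup>2 + 2 * (norm c)\<^sup>2"
  proof -
    have "(norm (b + c))\<^sup>2 + (norm (b - c))\<^sup>2 = 2 * (norm b)\<^sup>2 + 2 * (norm c)\<^sup>2"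
      unfolding power2_norm_eq_inner
      by (simp add: inner_add_left inner_add_right inner_diff_left inner_diff_right inner_commute)
    then show ?thesis using zero_le_power2[of "norm (b - c)"] by linarith
  qed
  then have "(\<eta> t)\<^sup>2 * (norm (b + c))\<^sup>2 \<le> (\<eta> t)\<^sup>2 * (2 * (norm b)\<^sup>2 + 2 * (norm c)\<^sup>2)"
    by (intro mult_left_mono) auto
  ultimately show ?thesis
    by (simp add: a_def b_def c_def algebra_simps)
qed

section \<open>Estimates relative to a fixed zero of the field\<close>

context
  fixes p assumes zero: "v p = 0"
begin

lemma norm_v_le: "(norm (v y))\<^sup>2 \<le> (norm (y - p))\<^sup>2 / l\<^sup>2"
  using power_mono[OF v_lipschitz[of y p], of 2] by (simp add: zero power_divide)

text \<open>Needed before expectations can be taken in \<open>distance_step\<close>. The triangle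
  inequality and the Lipschitz bound suffice, starting from a deterministic point.\<close>

lemma distance_L2: "integrable M (\<lambda>\<omega>. (norm (x t \<omega> - p))\<^sup>2)"
proof (induction t)
  case 0
  have "integrable M (\<lambda>\<omega>. (norm (x0 - p))\<^sup>2)" by simp
  then show ?case
    by (rule Bochner_Integration.integrable_cong[THEN iffD1, rotated 2]) (auto simp: x_init)
next
  case (Suc t)
  let ?g = "\<lambda>\<omega>. 3 * (norm (x t \<omega> - p))\<^sup>2 + 3 * (\<eta> t)\<^sup>2 * ((norm (x t \<omega> - p))\<^sup>2 / l\<^sup>2)
    + 3 * (\<eta> t)\<^sup>2 * (norm (\<xi> t \<omega>))\<^sup>2"
  have "integrable M ?g"
    using Suc \<xi>_L2 by simp
  then show ?case
  proof (rule Bochner_Integration.integrable_bound)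
    show "AE \<omega> in M. norm ((norm (x (Suc t) \<omega> - p))\<^sup>2) \<le> norm (?g \<omega>)"
    proof (rule AE_I2)
      fix \<omega> assume \<omega>: "\<omega> \<in> space M"
      define a b c where "a = norm (x t \<omega> - p)" and "b = \<eta> t * norm (v (x t \<omega>))"
        and "c = \<eta> t * norm (\<xi> t \<omega>)"
      have "norm (x (Suc t) \<omega> - p) \<le> a + b + c"
      proof -
        have "x (Suc t) \<omega> - p = (x t \<omega> - p) + \<eta> t *\<^sub>R v (x t \<omega>) + \<eta> t *\<^sub>R \<xi> t \<omega>"
          using x_step[OF \<omega>] by (simp add: algebra_simps)
        also have "norm \<dots> \<le> a + b + c"
          using \<eta>_pos[of t] unfolding a_def b_def c_def
          by (intro order_trans[OF norm_triangle_ineq] add_mono) auto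
        finally show ?thesis .
      qed
      then have "(norm (x (Suc t) \<omega> - p))\<^sup>2 \<le> (a + b + c)\<^sup>2"
        by (intro power_mono) auto
      also have "\<dots> \<le> 3 * a\<^sup>2 + 3 * b\<^sup>2 + 3 * c\<^sup>2"
        using sum_squares_bound[of a b] sum_squares_bound[of a c] sum_squares_bound[of b c]
        by (simp add: power2_eq_square algebra_simps)
      also have "\<dots> \<le> ?g \<omega>"
        using mult_left_mono[OF norm_v_le[of "x t \<omega>"], of "(\<eta> t)\<^sup>2"]
        by (simp add: a_def b_def c_def power_mult_distrib)
      finally show "norm ((norm (x (Suc t) \<omega> - p))\<^sup>2) \<le> norm (?g \<omega>)" by simp
    qed
  qed measurable
qed

lemma v_L2: "integrable M (\<lambda>\<omega>. (norm (v (x t \<omega>)))\<^sup>2)"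
proof (rule Bochner_Integration.integrable_bound)
  show "integrable M (\<lambda>\<omega>. (norm (x t \<omega> - p))\<^sup>2 / l\<^sup>2)"
    using distance_L2 by simp
qed (use norm_v_le in auto)

lemma x_minus_adapted: "(\<lambda>\<omega>. x t \<omega> - p) \<in> borel_measurable (F t)"
  using x_adapted by (intro borel_measurable_diff) auto

abbreviation increment :: "nat \<Rightarrow> 'w \<Rightarrow> real" where
  "increment t \<omega> \<equiv> 2 * \<eta> t * inner (x t \<omega> - p) (\<xi> t \<omega>)"

text \<open>Cauchy-Schwarz separates distance and noise; the distance is known at time
  \<open>t\<close>, so the noise contributes at most \<open>s\<close>.\<close>

lemma increment_square:
  "integrable M (\<lambda>\<omega>. (increment t \<omega>)\<^sup>2)"
  "(LINT \<omega>|M. (increment t \<omega>)\<^sup>2) \<le> 4 * (\<eta> t)\<^sup>2 * (s * (LINT \<omega>|M. (norm (x t \<omega> - p))\<^sup>2))"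
proof -
  let ?g = "\<lambda>\<omega>. 4 * (\<eta> t)\<^sup>2 * ((norm (x t \<omega> - p))\<^sup>2 * (norm (\<xi> t \<omega>))\<^sup>2)"
  have W: "integrable M (\<lambda>\<omega>. (norm (x t \<omega> - p))\<^sup>2 * (norm (\<xi> t \<omega>))\<^sup>2)"
    "(LINT \<omega>|M. (norm (x t \<omega> - p))\<^sup>2 * (norm (\<xi> t \<omega>))\<^sup>2) \<le> s * (LINT \<omega>|M. (norm (x t \<omega> - p))\<^sup>2)"
    using x_minus_adapted[of t] distance_L2
    by (auto intro!: integrable_weighted_noise)
  have le: "(increment t \<omega>)\<^sup>2 \<le> ?g \<omega>" for \<omega>
  proof -
    have "(inner (x t \<omega> - p) (\<xi> t \<omega>))\<^sup>2 \<le> (norm (x t \<omega> - p))\<^sup>2 * (norm (\<xi> t \<omega>))\<^sup>2"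
      using Cauchy_Schwarz_ineq[of "x t \<omega> - p" "\<xi> t \<omega>"] by (simp only: power2_norm_eq_inner)
    from mult_left_mono[OF this, of "4 * (\<eta> t)\<^sup>2"] show ?thesis
      by (simp add: power_mult_distrib)
  qed
  have G: "integrable M ?g" using W(1) by simp
  show I: "integrable M (\<lambda>\<omega>. (increment t \<omega>)\<^sup>2)"
    by (rule Bochner_Integration.integrable_bound[OF G]) (use le in auto)
  have "(LINT \<omega>|M. (increment t \<omega>)\<^sup>2) \<le> (LINT \<omega>|M. ?g \<omega>)"
    by (rule integral_mono[OF I G le])
  also have "\<dots> \<le> 4 * (\<eta> t)\<^sup>2 * (s * (LINT \<omega>|M. (norm (x t \<omega> - p))\<^sup>2))"
    using mult_left_mono[OF W(2), of "4 * (\<eta> t)\<^sup>2"] by simp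
  finally show "(LINT \<omega>|M. (increment t \<omega>)\<^sup>2) \<le> 4 * (\<eta> t)\<^sup>2 * (s * (LINT \<omega>|M. (norm (x t \<omega> - p))\<^sup>2))" .
qed

lemma increment_orthogonal:
  assumes "Z \<in> borel_measurable (F t)" "integrable M (\<lambda>\<omega>. (Z \<omega>)\<^sup>2)"
  shows "(LINT \<omega>|M. Z \<omega> * increment t \<omega>) = 0"
proof -
  have "(LINT \<omega>|M. Z \<omega> * increment t \<omega>) =
      (LINT \<omega>|M. 2 * \<eta> t * (Z \<omega> * inner (x t \<omega> - p) (\<xi> t \<omega>)))"
    by (simp only: mult.assoc mult.left_commute)
  also have "\<dots> = 0"
    using noise_orthogonal[OF x_minus_adapted distance_L2 assms] by simp
  finally show ?thesis .
qed

lemma increment_integrable: "integrable M (increment t)"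
proof -
  have "integrable M (\<lambda>\<omega>. 1 * increment t \<omega>)"
    by (rule integrable_mult_L2) (use increment_square(1) in auto)
  then show ?thesis by simp
qed

lemma mean_distance:
  shows "\<exists>B. \<forall>t. (LINT \<omega>|M. (norm (x t \<omega> - p))\<^sup>2) \<le> B"
    and "summable (\<lambda>t. 2 * \<eta> t * l * (LINT \<omega>|M. (norm (v (x t \<omega>)))\<^sup>2))"
proof -
  define a where "a t = (LINT \<omega>|M. (norm (x t \<omega> - p))\<^sup>2)" for t
  define V where "V t = (LINT \<omega>|M. (norm (v (x t \<omega>)))\<^sup>2)" for t
  \<comment> \<open>\<open>b\<close> absorbs the second-order field term through
    \<open>norm_v_le\<close>, and \<open>c\<close> bounds the mean noise energy.\<close>
  define b where "b t = 2 * (\<eta> t)\<^sup>2 / l\<^sup>2" for t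
  define c where "c t = 2 * (\<eta> t)\<^sup>2 * C" for t
  have C: "0 \<le> C" using \<xi>_bound[of 0] by (auto intro: order_trans[rotated] integral_nonneg_AE)
  have nonneg: "0 \<le> a t" "0 \<le> b t" "0 \<le> c t" "0 \<le> 2 * \<eta> t * l * V t" for t
    using \<eta>_pos[of t] l_pos C by (auto simp: a_def b_def c_def V_def)
  have step: "a (Suc t) + 2 * \<eta> t * l * V t \<le> (1 + b t) * a t + c t" for t
  proof -
    have "(LINT \<omega>|M. (norm (x (Suc t) \<omega> - p))\<^sup>2) \<le> (LINT \<omega>|M. (norm (x t \<omega> - p))\<^sup>2 + increment t \<omega>
        + 2 * (\<eta> t)\<^sup>2 * (norm (v (x t \<omega>)))\<^sup>2 + 2 * (\<eta> t)\<^sup>2 * (norm (\<xi> t \<omega>))\<^sup>2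
        - 2 * \<eta> t * l * (norm (v (x t \<omega>)))\<^sup>2)"
      using distance_L2 v_L2 \<xi>_L2 increment_integrable
      by (intro integral_mono distance_step zero) auto
    also have "\<dots> = a t + (LINT \<omega>|M. increment t \<omega>) + 2 * (\<eta> t)\<^sup>2 * V t
        + 2 * (\<eta> t)\<^sup>2 * (LINT \<omega>|M. (norm (\<xi> t \<omega>))\<^sup>2) - 2 * \<eta> t * l * V t"
      using distance_L2[of t] v_L2[of t] \<xi>_L2[of t] increment_integrable[of t]
      by (simp add: a_def V_def)
    finally have 1: "a (Suc t) \<le> \<dots>" by (simp only: a_def)
    have "(LINT \<omega>|M. increment t \<omega>) = 0"
      using increment_orthogonal[of "\<lambda>_. 1" t] by simp
    moreover have "2 * (\<eta> t)\<^sup>2 * (LINT \<omega>|M. (norm (\<xi> t \<omega>))\<^sup>2) \<le> c t"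
      unfolding c_def using \<xi>_bound by (intro mult_left_mono) auto
    moreover have "V t \<le> a t / l\<^sup>2"
    proof -
      have "V t \<le> (LINT \<omega>|M. (norm (x t \<omega> - p))\<^sup>2 / l\<^sup>2)"
        unfolding V_def using distance_L2 v_L2 norm_v_le by (intro integral_mono) auto
      then show ?thesis by (simp add: a_def)
    qed
    then have "2 * (\<eta> t)\<^sup>2 * V t \<le> b t * a t"
      using mult_left_mono[of "V t" "a t / l\<^sup>2" "2 * (\<eta> t)\<^sup>2"] by (simp add: b_def)
    ultimately show ?thesis using 1 by (simp add: algebra_simps)
  qed
  have "summable b" "summable c"
    unfolding b_def c_def using \<eta>_square_summable
    by (auto intro!: summable_divide summable_mult summable_mult2)
  note gronwall = discrete_gronwall[of a b c "\<lambda>t. 2 * \<eta> t * l * V t", OF nonneg step this]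
  show "\<exists>B. \<forall>t. (LINT \<omega>|M. (norm (x t \<omega> - p))\<^sup>2) \<le> B"
    and "summable (\<lambda>t. 2 * \<eta> t * l * (LINT \<omega>|M. (norm (v (x t \<omega>)))\<^sup>2))"
    using gronwall by (simp_all only: a_def V_def)
qed

section \<open>Almost sure convergence of the distance to a fixed zero\<close>

lemma AE_summable_field: "AE \<omega> in M. summable (\<lambda>t. \<eta> t * (norm (v (x t \<omega>)))\<^sup>2)"
proof (rule AE_summable_of_summable_integral)
  have "summable (\<lambda>t. (2 * \<eta> t * l * (LINT \<omega>|M. (norm (v (x t \<omega>)))\<^sup>2)) * (1 / (2 * l)))"
    using mean_distance(2) by (rule summable_mult2)
  then show "summable (\<lambda>t. LINT \<omega>|M. \<eta> t * (norm (v (x t \<omega>)))\<^sup>2)"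
    using l_pos by simp
qed (use v_L2 in \<open>auto intro!: mult_nonneg_nonneg less_imp_le[OF \<eta>_pos]\<close>)

text \<open>The bounded mean squared distance makes the variances at most a constant times the
  squared step sizes.\<close>

lemma AE_summable_increment: "AE \<omega> in M. summable (\<lambda>t. increment t \<omega>)"
proof -
  interpret orthogonal_increments M F increment
  proof unfold_locales
    fix t
    have [measurable]: "x t \<in> borel_measurable (F (Suc t))" "\<xi> t \<in> borel_measurable (F (Suc t))"
      by (rule measurable_from_subalg[OF subalg_mono x_adapted]) (simp, rule \<xi>_adapted)
    show "increment t \<in> borel_measurable (F (Suc t))" by measurable
  qed (use subalg_M subalg_mono increment_square increment_orthogonal in auto)
  obtain B where B: "(LINT \<omega>|M. (norm (x t \<omega> - p))\<^sup>2) \<le> B" for t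
    using mean_distance(1) by blast
  have "summable (\<lambda>t. LINT \<omega>|M. (increment t \<omega>)\<^sup>2)"
  proof (rule summable_comparison_test')
    show "summable (\<lambda>t. 4 * (\<eta> t)\<^sup>2 * (s * B))"
      using \<eta>_square_summable by (intro summable_mult summable_mult2)
    fix t
    have "(LINT \<omega>|M. (increment t \<omega>)\<^sup>2) \<le> 4 * (\<eta> t)\<^sup>2 * (s * (LINT \<omega>|M. (norm (x t \<omega> - p))\<^sup>2))"
      by (rule increment_square)
    also have "\<dots> \<le> 4 * (\<eta> t)\<^sup>2 * (s * B)"
      by (intro mult_left_mono B s_nonneg) auto
    finally show "norm (LINT \<omega>|M. (increment t \<omega>)\<^sup>2) \<le> 4 * (\<eta> t)\<^sup>2 * (s * B)"
      by (simp add: integral_nonneg_AE)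
  qed
  then show ?thesis by (rule AE_summable_increments)
qed

text \<open>Pathwise, the dissipative term of \<open>distance_step\<close> is dropped and all other
  increments are summable almost surely.\<close>

lemma AE_convergent_distance: "AE \<omega> in M. convergent (\<lambda>t. norm (x t \<omega> - p))"
proof -
  have noise: "AE \<omega> in M. summable (\<lambda>t. 2 * (\<eta> t)\<^sup>2 * (norm (\<xi> t \<omega>))\<^sup>2)"
  proof (rule AE_summable_of_summable_integral)
    show "summable (\<lambda>t. LINT \<omega>|M. 2 * (\<eta> t)\<^sup>2 * (norm (\<xi> t \<omega>))\<^sup>2)"
    proof (rule summable_comparison_test')
      show "summable (\<lambda>t. 2 * (\<eta> t)\<^sup>2 * C)"
        using \<eta>_square_summable by (intro summable_mult summable_mult2)
      show "norm (LINT \<omega>|M. 2 * (\<eta> t)\<^sup>2 * (norm (\<xi> t \<omega>))\<^sup>2) \<le> 2 * (\<eta> t)\<^sup>2 * C" for t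
        using mult_left_mono[OF \<xi>_bound[of t], of "2 * (\<eta> t)\<^sup>2"]
        by (simp add: integral_nonneg_AE abs_mult)
    qed
  qed (use \<xi>_L2 in auto)
  \<comment> \<open>Once \<open>\<eta> t \<le> 1\<close>, its square is at most
    \<open>\<eta> t\<close>, so the second-order field term is dominated by the series of
    \<open>AE_summable_field\<close>.\<close>
  obtain N where N: "\<eta> t \<le> 1" if "N \<le> t" for t
  proof -
    have "(\<lambda>t. (\<eta> t)\<^sup>2) \<longlonglongrightarrow> 0"
      by (rule summable_LIMSEQ_zero[OF \<eta>_square_summable])
    then have "eventually (\<lambda>t. (\<eta> t)\<^sup>2 < 1\<^sup>2) sequentially"
      by (rule order_tendstoD(2)) simp
    then have "eventually (\<lambda>t. \<eta> t \<le> 1) sequentially"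
      by eventually_elim (rule less_imp_le, erule power_less_imp_less_base, simp)
    then show thesis using that by (auto simp: eventually_sequentially)
  qed
  show ?thesis
    using noise AE_summable_field AE_summable_increment AE_space
  proof eventually_elim
    case (elim \<omega>)
    let ?e = "\<lambda>t. 2 * (\<eta> t)\<^sup>2 * (norm (v (x t \<omega>)))\<^sup>2"
    have "summable ?e"
    proof (rule summable_comparison_test'[where N = N])
      show "summable (\<lambda>t. 2 * (\<eta> t * (norm (v (x t \<omega>)))\<^sup>2))"
        using elim(2) by (rule summable_mult)
      show "norm (?e t) \<le> 2 * (\<eta> t * (norm (v (x t \<omega>)))\<^sup>2)" if "N \<le> t" for t
        using N[OF that] \<eta>_pos[of t]
        by (simp add: power2_eq_square mult_left_le_one_le)
    qed
    then have "summable (\<lambda>t. increment t \<omega> + (?e t + 2 * (\<eta> t)\<^sup>2 * (norm (\<xi> t \<omega>))\<^sup>2))"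
      using elim by (intro summable_add)
    then have "convergent (\<lambda>t. (norm (x t \<omega> - p))\<^sup>2)"
    proof (rule convergent_of_summable_increments[rotated 2])
      fix t
      have "0 \<le> 2 * \<eta> t * l * (norm (v (x t \<omega>)))\<^sup>2"
        using \<eta>_pos[of t] l_pos by simp
      then show "(norm (x (Suc t) \<omega> - p))\<^sup>2 \<le> (norm (x t \<omega> - p))\<^sup>2 +
          (increment t \<omega> + (?e t + 2 * (\<eta> t)\<^sup>2 * (norm (\<xi> t \<omega>))\<^sup>2))"
        using distance_step[OF zero, of \<omega> t] elim by linarith
    qed simp
    then obtain L where "(\<lambda>t. (norm (x t \<omega> - p))\<^sup>2) \<longlonglongrightarrow> L"
      unfolding convergent_def by blast
    from tendsto_real_sqrt[OF this] show ?case
      by (auto simp: convergent_def)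
  qed
qed

end

text \<open>The exceptional null set of \<open>AE_convergent_distance\<close> depends on \<open>p\<close>, so the distances are
  controlled on a countable dense set of zeros, which suffices to reach the random limit point.\<close>

proposition AE_infdist_zeros:
  assumes "{p. v p = 0} \<noteq> {}"
  shows "AE \<omega> in M. (\<lambda>t. infdist (x t \<omega>) {p. v p = 0}) \<longlonglongrightarrow> 0"
proof -
  let ?Z = "{p. v p = 0}"
  obtain D where D: "countable D" "D \<subseteq> ?Z" "?Z \<subseteq> closure D"
    by (rule separable)
  with assms obtain p where p: "p \<in> D" by fastforce
  have "AE \<omega> in M. \<forall>q\<in>D. convergent (\<lambda>t. norm (x t \<omega> - q))"
    using D by (subst AE_ball_countable) (auto intro: AE_convergent_distance)
  moreover have "AE \<omega> in M. summable (\<lambda>t. \<eta> t * (norm (v (x t \<omega>)))\<^sup>2)"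
    using p D by (intro AE_summable_field[of p]) auto
  ultimately show ?thesis
  proof eventually_elim
    case (elim \<omega>)
    let ?x = "\<lambda>t. x t \<omega>"
    have "\<exists>t\<ge>n. (norm (v (?x t)))\<^sup>2 < (1 / Suc n)\<^sup>2" for n
      using \<eta>_pos \<eta>_not_summable elim(2)
      by (intro frequently_small_of_weighted_summable[of \<eta>]) (auto intro: less_imp_le)
    then obtain r where r: "n \<le> r n" "(norm (v (?x (r n))))\<^sup>2 < (1 / Suc n)\<^sup>2" for n
      by metis
    have "norm (v (?x (r n))) \<le> 1 / Suc n" for n
      using power_less_imp_less_base[OF r(2)[of n]] by simp
    then have "(\<lambda>n. v (?x (r n))) \<longlonglongrightarrow> 0"
      by (intro Lim_null_comparison[OF _ LIMSEQ_inverse_real_of_nat])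
        (auto simp: inverse_eq_divide)
    have "Bseq (\<lambda>t. norm (?x t - p))"
      using elim(1) p by (intro convergent_imp_Bseq) auto
    then obtain K where K: "norm (?x t - p) \<le> K" for t
      by (auto simp: Bseq_def)
    have "compact (cball p K)" by simp
    moreover have "\<forall>n. ?x (r n) \<in> cball p K"
      using K by (auto simp: dist_norm norm_minus_commute)
    ultimately obtain y q where q: "strict_mono q" "(\<lambda>n. ?x (r (q n))) \<longlonglongrightarrow> y"
      unfolding compact_def comp_def by meson
    have "(\<lambda>n. v (?x (r (q n)))) \<longlonglongrightarrow> v y"
      using continuous_on_tendsto_compose[OF v_continuous q(2)] by simp
    moreover have "(\<lambda>n. v (?x (r (q n)))) \<longlonglongrightarrow> 0"
      using LIMSEQ_subseq_LIMSEQ[OF \<open>(\<lambda>n. v (?x (r n))) \<longlonglongrightarrow> 0\<close> q(1)] by (simp add: comp_def)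
    ultimately have y: "v y = 0"
      by (rule LIMSEQ_unique)
    \<comment> \<open>\<open>r\<close> need not be monotone; \<open>n \<le> r n\<close> is enough
      for the indices to tend to infinity.\<close>
    have rq: "filterlim (\<lambda>n. r (q n)) at_top sequentially"
      by (rule filterlim_at_top_mono[OF filterlim_subseq[OF q(1)]]) (simp add: r(1))
    show ?case
    proof (rule LIMSEQ_I)
      fix e :: real assume "0 < e"
      obtain z where z: "z \<in> D" "dist z y < e"
        using y D(3) \<open>0 < e\<close> closure_approachable[of y D] by blast
      obtain c where c: "(\<lambda>t. norm (?x t - z)) \<longlonglongrightarrow> c"
        using elim(1) z(1) by (auto simp: convergent_def)
      \<comment> \<open>The subsequence identifies the limit of the whole sequence of distances to
        \<open>z\<close> as \<open>norm (y - z)\<close>, which is below \<open>e\<close>.\<close>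
      have "(\<lambda>n. norm (?x (r (q n)) - z)) \<longlonglongrightarrow> c"
        using filterlim_compose[OF c rq] .
      moreover have "(\<lambda>n. norm (?x (r (q n)) - z)) \<longlonglongrightarrow> norm (y - z)"
        by (intro tendsto_intros q)
      ultimately have "c = norm (y - z)"
        by (rule LIMSEQ_unique)
      then have "c < e"
        using z(2) by (simp add: dist_norm norm_minus_commute)
      then have "eventually (\<lambda>t. norm (?x t - z) < e) sequentially"
        using c by (rule order_tendstoD(2)[rotated])
      then obtain N where N: "norm (?x t - z) < e" if "N \<le> t" for t
        by (auto simp: eventually_sequentially)
      have "norm (infdist (?x t) ?Z - 0) < e" if "N \<le> t" for t
        using infdist_le[of z ?Z "?x t"] N[OF that] z(1) D(2) infdist_nonneg[of "?x t" ?Z]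
        by (auto simp: dist_norm)
      then show "\<exists>N. \<forall>t\<ge>N. norm (infdist (?x t) ?Z - 0) < e" by blast
    qed
  qed
qed

end

section \<open>Application to noisy gradient descent in a game\<close>

theorem theoremA2:
  fixes own :: "'k::finite \<Rightarrow> 'i::finite"
    and u :: "'i \<Rightarrow> real ^ 'k \<Rightarrow> real"
    and l :: real
    and M :: "'w measure"
    and F :: "nat \<Rightarrow> 'w measure"
    and x :: "nat \<Rightarrow> 'w \<Rightarrow> real ^ 'k"
    and x0 :: "real ^ 'k"
    and \<xi> :: "nat \<Rightarrow> 'w \<Rightarrow> real ^ 'k"
    and \<eta> \<sigma> :: "nat \<Rightarrow> real"
    and \<sigma>max :: real
  assumes "l > 0"
    and "cocoercive_game l own u"
    and "nash_equilibria own u \<noteq> {}"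
    and "prob_space M"
    and "filtration (space M) F"
    and "\<And>t. subalgebra M (F t)"
    and "\<And>t. x t \<in> borel_measurable (F t)"
    and "\<And>\<omega>. \<omega> \<in> space M \<Longrightarrow> x 0 \<omega> = x0"
    and "\<And>t \<omega>. \<omega> \<in> space M \<Longrightarrow>
           x (Suc t) \<omega> = x t \<omega> + \<eta> (Suc t) *\<^sub>R (gradient_field own u (x t \<omega>) + \<xi> (Suc t) \<omega>)"
    and "L2_bounded_martingale_difference M F \<xi>"
    and "\<And>t. AE \<omega> in M. real_cond_exp M (F t) (\<lambda>\<omega>'. (norm (\<xi> (Suc t) \<omega>'))\<^sup>2) \<omega> \<le> (\<sigma> t)\<^sup>2"
    and "\<And>t. (\<sigma> t)\<^sup>2 \<in> {0<..\<sigma>max\<^sup>2}"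
    and "\<And>t. t \<ge> 1 \<Longrightarrow> \<eta> t > 0"
    and "\<And>s t. 1 \<le> s \<Longrightarrow> s \<le> t \<Longrightarrow> \<eta> t \<le> \<eta> s"
    and "filterlim (\<lambda>T. \<Sum>t=1..T. \<eta> t) at_top sequentially"
    and "summable (\<lambda>t. (\<eta> (Suc t))\<^sup>2)"
  shows "AE \<omega> in M. (\<lambda>t. infdist (x t \<omega>) (nash_equilibria own u)) \<longlonglongrightarrow> 0"
proof -
  let ?v = "gradient_field own u"
  have game: "continuous_game own u"
    and coco: "\<And>y y'. inner (y' - y) (?v y' - ?v y) \<le> - l * (norm (?v y' - ?v y))\<^sup>2"
    using assms(2) by (auto simp: cocoercive_game_def)
  have mono: "inner (y' - y) (?v y' - ?v y) \<le> 0" for y y'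
    using coco[of y' y] \<open>l > 0\<close> by (smt (verit) mult_nonneg_nonneg mult_minus_left zero_le_power2)
  have nash: "nash_equilibria own u = {p. ?v p = 0}"
    using gradient_field_eq_0_if_nash[OF game] nash_if_gradient_field_eq_0[OF game mono] by blast
  obtain C where C: "\<And>t. t \<ge> 1 \<Longrightarrow> (LINT \<omega>|M. (norm (\<xi> t \<omega>))\<^sup>2) \<le> C"
    using assms(10) unfolding L2_bounded_martingale_difference_def by blast
  interpret prob_space M by fact
  \<comment> \<open>Noise and step sizes are shifted by one index, and the largest variance bound
    serves uniformly in time.\<close>
  interpret cocoercive_iteration M F ?v l x "\<lambda>t. \<xi> (Suc t)" x0 "\<lambda>t. \<eta> (Suc t)" "\<sigma>max\<^sup>2" C
  proof unfold_locales
    show "subalgebra (F t) (F s)" if "s \<le> t" for s t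
      using assms(5) that by (auto simp: filtration_def subalgebra_def)
    show "AE \<omega> in M. real_cond_exp M (F t) (\<lambda>\<omega>'. (norm (\<xi> (Suc t) \<omega>'))\<^sup>2) \<omega> \<le> \<sigma>max\<^sup>2" for t
      using assms(11)[of t] assms(12)[of t] by (auto elim!: eventually_mono)
    show "\<not> summable (\<lambda>t. \<eta> (Suc t))"
    proof
      assume "summable (\<lambda>t. \<eta> (Suc t))"
      then have "(\<lambda>n. \<Sum>t<n. \<eta> (Suc t)) \<longlonglongrightarrow> (\<Sum>t. \<eta> (Suc t))"
        by (rule summable_LIMSEQ)
      moreover have "(\<Sum>t<n. \<eta> (Suc t)) = (\<Sum>t=1..n. \<eta> t)" for n
        by (simp add: sum.atLeast1_atMost_eq)
      ultimately have "(\<lambda>n. \<Sum>t=1..n. \<eta> t) \<longlonglongrightarrow> (\<Sum>t. \<eta> (Suc t))" by simp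
      then show False
        using not_tendsto_and_filterlim_at_infinity[OF sequentially_bot _
            filterlim_at_top_imp_at_infinity[OF assms(15)]] by blast
    qed
  qed (use assms(1,6-10,13,16) coco C in
      \<open>auto simp: L2_bounded_martingale_difference_def\<close>)
  show ?thesis
    using AE_infdist_zeros assms(3) unfolding nash by blast
qed

end
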